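(* Let $f$ be a smooth function and let $M(v,r_v)$ be a smooth function on an open set $U$ of the $(v,r_v)$ half-plane $\{r_v>0\}$ whose intersection with each line $v=\text{const}$ is an interval (possibly empty). Consider the generalized Vaidya metric $$ds^2=-\left(1-\frac{2M(v,r_v)}{r_v}\right)dv^2+2\,dv\,dr_v+r_v^2\,d\Omega^2$$ and an energy-momentum tensor of the form $$T_{\mu\nu}=\mu\,l_\mu l_\nu+(\rho+p)(l_\mu n_\nu+l_\nu n_\mu)+p\,g_{\mu\nu},$$ with functions $\mu,\rho,p$, where in coordinates $(x^0,x^1,x^2,x^3)=(v,r_v,\theta,\varphi)$ one has $l_\mu=\delta^0_\mu$ and $n_\mu=\frac12\left(1-\frac{2M(v,r_v)}{r_v}\right)\delta^0_\mu-\delta^1_\mu$. Then the $(1,1)$ (i.e. $r_vr_v$) component of the metric $f(R)$ field equations $$f_{,R}R_{\mu\nu}-\tfrac12 f(R)g_{\mu\nu}+(g_{\mu\nu}\Box-\nabla_\mu\nabla_\nu)f_{,R}=\kappa\,T_{\mu\nu}$$ implies $$f_{,R}(R(v,r_v))=A(v)\,r_v+B(v)$$ for some functions $A(v)$, $B(v)$ of the null coordinate $v$ alone.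
   Context: $f_{,R}=df/dR$, evaluated on the Ricci scalar $R=R(v,r_v)$ of the metric; $R_{\mu\nu}$ is the Ricci tensor, $\nabla$ the Levi-Civita connection, $\Box=g^{\mu\nu}\nabla_\mu\nabla_\nu$, and $\kappa=8\pi G$ a constant. The metric is assumed to have signature $(-,+,+,+)$ and $d\Omega^2=d\theta^2+\sin^2\theta\,d\varphi^2$. *)

theory Defs
  imports "HOL-Analysis.Analysis"
begin

section \<open>Smooth functions on open sets\<close>

fun differentiable_times ::
    "nat \<Rightarrow> 'a::real_normed_vector set \<Rightarrow> ('a \<Rightarrow> 'b::real_normed_vector) \<Rightarrow> bool" where
  "differentiable_times 0 S F \<longleftrightarrow> continuous_on S F"
| "differentiable_times (Suc k) S F \<longleftrightarrow>
     (\<forall>x\<in>S. F differentiable (at x)) \<and>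
     (\<forall>v. differentiable_times k S (\<lambda>x. frechet_derivative F (at x) v))"

text \<open>\<open>C\<^sup>\<infinity>\<close>; intended for open \<open>S\<close> only, since derivatives are taken \<open>at x\<close>
  rather than \<open>at x within S\<close>.\<close>

definition smooth_on ::
    "'a::real_normed_vector set \<Rightarrow> ('a \<Rightarrow> 'b::real_normed_vector) \<Rightarrow> bool" where
  "smooth_on S F \<longleftrightarrow> (\<forall>k. differentiable_times k S F)"

section \<open>Tensor calculus in a coordinate chart of dimension four\<close>

text \<open>Points are coordinate vectors \<open>x :: real ^ 4\<close> and a covariant 2-tensor field has type
  \<open>real ^ 4 \<Rightarrow> real ^ 4 ^ 4\<close>. The index type \<open>4\<close> is the ring of integers modulo 4, whose
  elements are \<open>0, 1, 2, 3\<close>, so the components are \<open>x $ 0, \<dots>, x $ 3\<close>.\<close>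

lemma UNIV_index: "(UNIV :: 4 set) = {0, 1, 2, 3}"
proof -
  have *: "(4 :: 4) = 0" by simp
  show ?thesis unfolding UNIV_4 * by blast
qed

lemma sum_index: "(\<Sum>i\<in>UNIV. F (i :: 4)) = F 0 + F 1 + F 2 + F 3"
  for F :: "4 \<Rightarrow> 'a::comm_monoid_add"
proof -
  have *: "(4 :: 4) = 0" by simp
  show ?thesis unfolding sum_4 * by (simp only: ac_simps)
qed

definition partial :: "4 \<Rightarrow> (real ^ 4 \<Rightarrow> real) \<Rightarrow> real ^ 4 \<Rightarrow> real" where
  "partial i F x = deriv (\<lambda>t. F (x + t *\<^sub>R axis i 1)) 0"

text \<open>\<open>christoffel g x a b c\<close> is \<open>\<Gamma>\<^sup>a\<^sub>b\<^sub>c\<close> of the Levi-Civita connection.\<close>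

definition christoffel :: "(real ^ 4 \<Rightarrow> real ^ 4 ^ 4) \<Rightarrow> real ^ 4 \<Rightarrow> 4 \<Rightarrow> 4 \<Rightarrow> 4 \<Rightarrow> real" where
  "christoffel g x a b c =
     (\<Sum>d\<in>UNIV. matrix_inv (g x) $ a $ d *
        (partial b (\<lambda>y. g y $ d $ c) x + partial c (\<lambda>y. g y $ d $ b) x
         - partial d (\<lambda>y. g y $ b $ c) x)) / 2"

text \<open>\<open>riemann g x a b c d\<close> is \<open>R\<^sup>a\<^sub>b\<^sub>c\<^sub>d = \<partial>\<^sub>c \<Gamma>\<^sup>a\<^sub>d\<^sub>b - \<partial>\<^sub>d \<Gamma>\<^sup>a\<^sub>c\<^sub>b + \<dots>\<close>, and the Ricci tensor is
  \<open>R\<^sub>b\<^sub>d = R\<^sup>a\<^sub>b\<^sub>a\<^sub>d\<close>; with this sign convention round spheres have positive scalar curvature.\<close>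

definition riemann ::
    "(real ^ 4 \<Rightarrow> real ^ 4 ^ 4) \<Rightarrow> real ^ 4 \<Rightarrow> 4 \<Rightarrow> 4 \<Rightarrow> 4 \<Rightarrow> 4 \<Rightarrow> real" where
  "riemann g x a b c d =
     partial c (\<lambda>y. christoffel g y a d b) x - partial d (\<lambda>y. christoffel g y a c b) x
     + (\<Sum>e\<in>UNIV. christoffel g x a c e * christoffel g x e d b)
     - (\<Sum>e\<in>UNIV. christoffel g x a d e * christoffel g x e c b)"

definition ricci :: "(real ^ 4 \<Rightarrow> real ^ 4 ^ 4) \<Rightarrow> real ^ 4 \<Rightarrow> real ^ 4 ^ 4" where
  "ricci g x = (\<chi> b d. \<Sum>a\<in>UNIV. riemann g x a b a d)"

text \<open>The trace \<open>g\<^sup>\<mu>\<^sup>\<nu> S\<^sub>\<mu>\<^sub>\<nu>\<close>.\<close>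

definition metric_trace ::
    "(real ^ 4 \<Rightarrow> real ^ 4 ^ 4) \<Rightarrow> (real ^ 4 \<Rightarrow> real ^ 4 ^ 4) \<Rightarrow> real ^ 4 \<Rightarrow> real" where
  "metric_trace g S x = (\<Sum>i\<in>UNIV. \<Sum>j\<in>UNIV. matrix_inv (g x) $ i $ j * S x $ i $ j)"

definition ricci_scalar :: "(real ^ 4 \<Rightarrow> real ^ 4 ^ 4) \<Rightarrow> real ^ 4 \<Rightarrow> real" where
  "ricci_scalar g x = metric_trace g (ricci g) x"

definition differential :: "(real ^ 4 \<Rightarrow> real) \<Rightarrow> real ^ 4 \<Rightarrow> real ^ 4" where
  "differential \<phi> x = (\<chi> i. partial i \<phi> x)"

text \<open>The covariant derivative \<open>\<nabla>\<^sub>i \<omega>\<^sub>j\<close> of a covector field.\<close>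

definition cov_deriv ::
    "(real ^ 4 \<Rightarrow> real ^ 4 ^ 4) \<Rightarrow> (real ^ 4 \<Rightarrow> real ^ 4) \<Rightarrow> real ^ 4 \<Rightarrow> real ^ 4 ^ 4" where
  "cov_deriv g \<omega> x =
     (\<chi> i j. partial i (\<lambda>y. \<omega> y $ j) x - (\<Sum>k\<in>UNIV. christoffel g x k i j * \<omega> x $ k))"

definition hessian ::
    "(real ^ 4 \<Rightarrow> real ^ 4 ^ 4) \<Rightarrow> (real ^ 4 \<Rightarrow> real) \<Rightarrow> real ^ 4 \<Rightarrow> real ^ 4 ^ 4" where
  "hessian g \<phi> = cov_deriv g (differential \<phi>)"

definition dalembertian :: "(real ^ 4 \<Rightarrow> real ^ 4 ^ 4) \<Rightarrow> (real ^ 4 \<Rightarrow> real) \<Rightarrow> real ^ 4 \<Rightarrow> real" where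
  "dalembertian g \<phi> x = metric_trace g (hessian g \<phi>) x"

section \<open>Metric \<open>f(R)\<close> gravity\<close>

definition f_R :: "(real \<Rightarrow> real) \<Rightarrow> (real ^ 4 \<Rightarrow> real ^ 4 ^ 4) \<Rightarrow> real ^ 4 \<Rightarrow> real" where
  "f_R f g x = deriv f (ricci_scalar g x)"

definition fR_field_tensor ::
    "(real \<Rightarrow> real) \<Rightarrow> (real ^ 4 \<Rightarrow> real ^ 4 ^ 4) \<Rightarrow> real ^ 4 \<Rightarrow> real ^ 4 ^ 4" where
  "fR_field_tensor f g x =
     (\<chi> i j. f_R f g x * ricci g x $ i $ j
        - f (ricci_scalar g x) * g x $ i $ j / 2
        + (g x $ i $ j * dalembertian g (f_R f g) x - hessian g (f_R f g) x $ i $ j))"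

section \<open>The generalized Vaidya spacetime\<close>

text \<open>Coordinates \<open>(x $ 0, x $ 1, x $ 2, x $ 3) = (v, r\<^sub>v, \<theta>, \<phi>)\<close>; the spherical coordinates
  range over the standard chart of the two-sphere.\<close>

definition vaidya_chart :: "(real \<times> real) set \<Rightarrow> (real ^ 4) set" where
  "vaidya_chart U = {x. (x $ 0, x $ 1) \<in> U \<and> 0 < x $ 2 \<and> x $ 2 < pi \<and> 0 < x $ 3 \<and> x $ 3 < 2 * pi}"

text \<open>The off-diagonal entries are 1 because \<open>2 dv dr\<^sub>v\<close> is the sum of the
  \<open>(0,1)\<close> and \<open>(1,0)\<close> contributions.\<close>

definition vaidya_metric :: "(real \<times> real \<Rightarrow> real) \<Rightarrow> real ^ 4 \<Rightarrow> real ^ 4 ^ 4" where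
  "vaidya_metric M x =
     (\<chi> i j.
        if i = 0 \<and> j = 0 then - (1 - 2 * M (x $ 0, x $ 1) / x $ 1)
        else if (i = 0 \<and> j = 1) \<or> (i = 1 \<and> j = 0) then 1
        else if i = 2 \<and> j = 2 then (x $ 1)\<^sup>2
        else if i = 3 \<and> j = 3 then (x $ 1)\<^sup>2 * (sin (x $ 2))\<^sup>2
        else 0)"

definition vaidya_l :: "real ^ 4 \<Rightarrow> real ^ 4" where
  "vaidya_l x = axis 0 1"

definition vaidya_n :: "(real \<times> real \<Rightarrow> real) \<Rightarrow> real ^ 4 \<Rightarrow> real ^ 4" where
  "vaidya_n M x = (1/2 * (1 - 2 * M (x $ 0, x $ 1) / x $ 1)) *\<^sub>R axis 0 1 - axis 1 1"

definition vaidya_stress ::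
    "(real \<times> real \<Rightarrow> real) \<Rightarrow> (real ^ 4 \<Rightarrow> real) \<Rightarrow> (real ^ 4 \<Rightarrow> real) \<Rightarrow> (real ^ 4 \<Rightarrow> real)
      \<Rightarrow> real ^ 4 \<Rightarrow> real ^ 4 ^ 4" where
  "vaidya_stress M \<mu> \<rho> p x =
     (\<chi> i j. \<mu> x * vaidya_l x $ i * vaidya_l x $ j
        + (\<rho> x + p x) * (vaidya_l x $ i * vaidya_n M x $ j + vaidya_l x $ j * vaidya_n M x $ i)
        + p x * vaidya_metric M x $ i $ j)"

end

theory Submission
  imports Defs
begin

text \<open>Writing \<open>h = 1 - 2 M / r\<close> and letting \<open>'\<close> denote \<open>\<partial>\<^sub>r\<close>, the metric satisfies \<open>g\<^sub>1\<^sub>1 = 0\<close>, \<open>R\<^sub>1\<^sub>1 = 0\<close> and \<open>\<Gamma>\<^sup>k\<^sub>1\<^sub>1 = 0\<close>, while \<open>T\<^sub>1\<^sub>1 = 0\<close>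
  because \<open>l\<^sub>1 = 0\<close>. Hence the \<open>(1,1)\<close> equation reduces to \<open>\<partial>\<^sub>r\<^sup>2 f\<^sub>R = 0\<close>. The scalar curvature
  \<open>R = - h'' - 4 h' / r + 2 (1 - h) / r\<^sup>2\<close> is a smooth function of \<open>(v, r)\<close> alone, so \<open>f\<^sub>R\<close> is affine
  in \<open>r\<close> on each interval \<open>v = const\<close>.\<close>

section \<open>Coordinate derivatives and matrix inverses\<close>

lemma forall_index: "(\<forall>i :: 4. P i) \<longleftrightarrow> P 0 \<and> P 1 \<and> P 2 \<and> P 3"
proof -
  have "(\<forall>i :: 4. P i) \<longleftrightarrow> (\<forall>i\<in>UNIV. P i)" by simp
  then show ?thesis unfolding UNIV_index by simp
qed

lemma add_axis_nth: "(x + t *\<^sub>R axis i (1::real)) $ j = (if i = j then x $ j + t else x $ j)"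
  by (simp add: axis_def)

lemma partial_eqI:
  assumes "((\<lambda>t. F (x + t *\<^sub>R axis i 1)) has_real_derivative D) (at 0)"
  shows "partial i F x = D"
  using assms by (simp add: partial_def DERIV_imp_deriv)

lemma partial_const [simp]: "partial i (\<lambda>y. c) x = 0"
  by (rule partial_eqI) simp

text \<open>A short piece of the coordinate line through \<open>x\<close> stays in the open set
  \<open>S\<close>, so \<open>partial\<close> sees only values in \<open>S\<close>. Closed formulas
  valid only on the chart may thus be differentiated.\<close>

lemma partial_cong:
  assumes "open S" "x \<in> S" "\<And>y. y \<in> S \<Longrightarrow> F y = G y"
  shows "partial i F x = partial i G x"
proof -
  have "open ((\<lambda>t. x + t *\<^sub>R axis i 1) -` S)"
    by (rule open_vimage[OF assms(1)]) (auto intro!: continuous_intros)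
  then have "eventually (\<lambda>t. x + t *\<^sub>R axis i 1 \<in> S) (nhds (0 :: real))"
    using assms(2) by (auto simp: eventually_nhds)
  then have "eventually (\<lambda>t. F (x + t *\<^sub>R axis i 1) = G (x + t *\<^sub>R axis i 1)) (nhds (0 :: real))"
    by (rule eventually_mono) (use assms(3) in auto)
  then show ?thesis
    unfolding partial_def by (intro deriv_cong_ev) auto
qed

text \<open>\<open>matrix_inv\<close> is a Hilbert choice of a two-sided inverse. For square
  matrices a right inverse is also a left inverse, and uniqueness then fixes the choice.\<close>

lemma matrix_inv_eqI:
  fixes A :: "real ^ 'n ^ 'n"
  assumes "A ** B = mat 1"
  shows "matrix_inv A = B"
proof -
  have BA: "B ** A = mat 1"
    using assms matrix_left_right_inverse by blast
  have "B' = B" if "B' ** A = mat 1" for B'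
  proof -
    have "B' = B' ** (A ** B)" by (simp add: assms)
    also have "\<dots> = B' ** A ** B" by (rule matrix_mul_assoc)
    also have "\<dots> = B" by (simp add: that)
    finally show ?thesis .
  qed
  then show ?thesis
    unfolding matrix_inv_def using assms BA by (blast intro: some_equality)
qed

lemma riemann_diag [simp]: "riemann g x a b c c = 0"
  by (simp add: riemann_def)

lemma open_vaidya_chart:
  assumes "open U"
  shows "open (vaidya_chart U)"
proof -
  have "vaidya_chart U = (\<lambda>x. (x $ 0, x $ 1)) -` U \<inter> {x. 0 < x $ 2} \<inter> {x. x $ 2 < pi}
          \<inter> {x. 0 < x $ 3} \<inter> {x. x $ 3 < 2 * pi}"
    by (auto simp: vaidya_chart_def)
  moreover have "open ((\<lambda>x :: real ^ 4. (x $ 0, x $ 1)) -` U)"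
    by (rule open_vimage[OF assms]) (auto intro!: continuous_intros)
  ultimately show ?thesis
    by (auto intro!: open_Int open_Collect_less continuous_intros)
qed

text \<open>Passes from the chart to one real variable, for fields that depend on
  \<open>(v, r)\<close> alone; \<open>DERIV_shift\<close> moves the base point from \<open>0\<close>
  to \<open>x $ 1\<close>.\<close>

lemma partial_radial:
  assumes "open U" "x \<in> vaidya_chart U" "\<And>y. y \<in> vaidya_chart U \<Longrightarrow> F y = \<Phi> (y $ 0, y $ 1)"
    and "((\<lambda>s. \<Phi> (x $ 0, s)) has_real_derivative c) (at (x $ 1))"
  shows "partial 1 F x = c"
proof -
  have "partial 1 F x = partial 1 (\<lambda>y. \<Phi> (y $ 0, y $ 1)) x"
    using assms by (intro partial_cong[OF open_vaidya_chart]) auto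
  also have "\<dots> = c"
    using assms(4) DERIV_shift[of "\<lambda>s. \<Phi> (x $ 0, s)" _ 0 "x $ 1"]
    by (intro partial_eqI, unfold add_axis_nth) (simp add: add.commute)
  finally show ?thesis .
qed

section \<open>Curvature of the metric in terms of the lapse\<close>

definition lapse :: "(real \<times> real \<Rightarrow> real) \<Rightarrow> real \<times> real \<Rightarrow> real" where
  "lapse M p = 1 - 2 * M p / snd p"

text \<open>Hides \<open>M\<close>: the curvature computation treats the lapse as an unspecified
  function with two radial derivatives.\<close>

lemma vaidya_metric_lapse:
  "vaidya_metric M x = (\<chi> i j.
    if i = 0 \<and> j = 0 then - lapse M (x $ 0, x $ 1)
    else if i = 0 \<and> j = 1 \<or> i = 1 \<and> j = 0 then 1
    else if i = 2 \<and> j = 2 then (x $ 1)\<^sup>2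
    else if i = 3 \<and> j = 3 then (x $ 1)\<^sup>2 * (sin (x $ 2))\<^sup>2
    else 0)"
  unfolding vaidya_metric_def lapse_def snd_conv ..

text \<open>Only radial derivatives of the lapse enter below: \<open>\<partial>\<^sub>v h\<close> occurs solely in \<open>\<Gamma>\<^sup>1\<^sub>0\<^sub>0\<close>, which is
  never differentiated, so it can stay an unevaluated \<open>partial 0\<close>.\<close>

locale vaidya =
  fixes U :: "(real \<times> real) set" and M H1 H2 :: "real \<times> real \<Rightarrow> real"
  assumes open_U: "open U" and U_pos: "(v, r) \<in> U \<Longrightarrow> r > 0"
    and H_deriv: "(v, r) \<in> U \<Longrightarrow>
          ((\<lambda>s. lapse M (v, s)) has_real_derivative H1 (v, r)) (at r)"
    and H1_deriv: "(v, r) \<in> U \<Longrightarrow> ((\<lambda>s. H1 (v, s)) has_real_derivative H2 (v, r)) (at r)"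
begin

abbreviation g where "g \<equiv> vaidya_metric M"
abbreviation h where "h x \<equiv> lapse M (x $ 0, x $ 1)"

lemma chart_pos:
  assumes "x \<in> vaidya_chart U"
  shows "(x $ 0, x $ 1) \<in> U" "x $ 1 > 0" "sin (x $ 2) > 0"
  using assms U_pos sin_gt_zero by (auto simp: vaidya_chart_def)

text \<open>The locale assumption along the coordinate line through \<open>x\<close>, the form in
  which \<open>partial\<close> asks for it.\<close>

lemma h_radial_deriv:
  assumes "x \<in> vaidya_chart U"
  shows "((\<lambda>t. lapse M (x $ 0, x $ 1 + t)) has_real_derivative H1 (x $ 0, x $ 1)) (at 0)"
  using H_deriv[OF chart_pos(1)[OF assms]] DERIV_shift[of "\<lambda>s. lapse M (x $ 0, s)" _ 0 "x $ 1"]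
  by (simp add: add.commute)

lemma H1_radial_deriv:
  assumes "x \<in> vaidya_chart U"
  shows "((\<lambda>t. H1 (x $ 0, x $ 1 + t)) has_real_derivative H2 (x $ 0, x $ 1)) (at 0)"
  using H1_deriv[OF chart_pos(1)[OF assms]] DERIV_shift[of "\<lambda>s. H1 (x $ 0, s)" _ 0 "x $ 1"]
  by (simp add: add.commute)

text \<open>The \<open>(v, r)\<close> block has rows \<open>(-h, 1)\<close> and
  \<open>(1, 0)\<close>, hence determinant -1; the angular block is diagonal and nonzero because
  \<open>r > 0\<close> and \<open>sin \<theta> > 0\<close>.\<close>

lemma matrix_inv_vaidya:
  assumes "x \<in> vaidya_chart U"
  shows "matrix_inv (g x) = (\<chi> i j.
    if i = 0 \<and> j = 1 \<or> i = 1 \<and> j = 0 then 1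
    else if i = 1 \<and> j = 1 then h x
    else if i = 2 \<and> j = 2 then 1 / (x $ 1)\<^sup>2
    else if i = 3 \<and> j = 3 then 1 / ((x $ 1)\<^sup>2 * (sin (x $ 2))\<^sup>2)
    else 0)"
  using chart_pos[OF assms]
  by (intro matrix_inv_eqI)
    (simp add: vec_eq_iff forall_index matrix_matrix_mult_def mat_def sum_index vaidya_metric_lapse)

lemma partial_metric:
  assumes "x \<in> vaidya_chart U"
  shows "partial k (\<lambda>y. g y $ i $ j) x =
    (if i = 0 \<and> j = 0 then
       if k = 0 then partial 0 (\<lambda>y. - h y) x else if k = 1 then - H1 (x $ 0, x $ 1) else 0
     else if i = 2 \<and> j = 2 \<and> k = 1 then 2 * x $ 1
     else if i = 3 \<and> j = 3 \<and> k = 1 then 2 * x $ 1 * (sin (x $ 2))\<^sup>2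
     else if i = 3 \<and> j = 3 \<and> k = 2 then 2 * (x $ 1)\<^sup>2 * sin (x $ 2) * cos (x $ 2)
     else 0)" (is "?P k i j")
proof -
  have 1: "partial k (\<lambda>y. - h y) x = (if k = 1 then - H1 (x $ 0, x $ 1) else 0)" if "k \<noteq> 0" for k
  proof -
    have "((\<lambda>t. - lapse M (x $ 0, if k = 1 then x $ 1 + t else x $ 1)) has_real_derivative
        (if k = 1 then - H1 (x $ 0, x $ 1) else 0)) (at 0)"
      using h_radial_deriv[OF assms] by (auto intro!: derivative_eq_intros)
    with that show ?thesis
      by (intro partial_eqI, unfold add_axis_nth) simp
  qed
  have 2: "partial k (\<lambda>y. (y $ 1)\<^sup>2) x = (if k = 1 then 2 * x $ 1 else 0)" for k
    by (rule partial_eqI, unfold add_axis_nth) (auto intro!: derivative_eq_intros)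
  have 3: "partial k (\<lambda>y. (y $ 1)\<^sup>2 * (sin (y $ 2))\<^sup>2) x = 
      (if k = 1 then 2 * x $ 1 * (sin (x $ 2))\<^sup>2 else 
       if k = 2 then 2 * (x $ 1)\<^sup>2 * sin (x $ 2) * cos (x $ 2) else 0)" for k
    by (rule partial_eqI, unfold add_axis_nth) (auto intro!: derivative_eq_intros)
  \<comment> \<open>Quantifying the indices lets \<open>forall_index\<close> split the claim into
    its 64 components.\<close>
  have "\<forall>k i j. ?P k i j"
    unfolding forall_index by (simp add: vaidya_metric_lapse 1 2 3)
  then show ?thesis by blast
qed

text \<open>The Christoffel symbols in closed form; the last \<open>else\<close> branch is
  \<open>a = 3\<close>.\<close>

definition \<Gamma> :: "real ^ 4 \<Rightarrow> 4 \<Rightarrow> 4 \<Rightarrow> 4 \<Rightarrow> real" where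
  "\<Gamma> x a b c =
    (if a = 0 then
       if b = 0 \<and> c = 0 then H1 (x $ 0, x $ 1) / 2
       else if b = 2 \<and> c = 2 then - x $ 1
       else if b = 3 \<and> c = 3 then - (x $ 1 * (sin (x $ 2))\<^sup>2)
       else 0
     else if a = 1 then
       if b = 0 \<and> c = 0 then (partial 0 (\<lambda>y. - h y) x + h x * H1 (x $ 0, x $ 1)) / 2
       else if b = 0 \<and> c = 1 \<or> b = 1 \<and> c = 0 then - (H1 (x $ 0, x $ 1) / 2)
       else if b = 2 \<and> c = 2 then - (h x * x $ 1)
       else if b = 3 \<and> c = 3 then - (h x * x $ 1 * (sin (x $ 2))\<^sup>2)
       else 0
     else if a = 2 then
       if b = 1 \<and> c = 2 \<or> b = 2 \<and> c = 1 then 1 / x $ 1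
       else if b = 3 \<and> c = 3 then - (sin (x $ 2) * cos (x $ 2))
       else 0
     else
       if b = 1 \<and> c = 3 \<or> b = 3 \<and> c = 1 then 1 / x $ 1
       else if b = 2 \<and> c = 3 \<or> b = 3 \<and> c = 2 then cos (x $ 2) / sin (x $ 2)
       else 0)"

lemma christoffel_vaidya:
  assumes "x \<in> vaidya_chart U"
  shows "christoffel g x a b c = \<Gamma> x a b c"
proof -
  have "\<forall>a b c. christoffel g x a b c = \<Gamma> x a b c"
    unfolding christoffel_def partial_metric[OF assms] matrix_inv_vaidya[OF assms] sum_index
      forall_index \<Gamma>_def
    using chart_pos[OF assms] by (simp add: field_simps power2_eq_square)
  then show ?thesis by blast
qed

lemma riemann_vaidya:
  assumes "x \<in> vaidya_chart U"
  shows "riemann g x a b c d =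
     partial c (\<lambda>y. \<Gamma> y a d b) x - partial d (\<lambda>y. \<Gamma> y a c b) x
     + (\<Sum>e\<in>UNIV. \<Gamma> x a c e * \<Gamma> x e d b) - (\<Sum>e\<in>UNIV. \<Gamma> x a d e * \<Gamma> x e c b)"
proof -
  \<comment> \<open>Agreement at \<open>x\<close> alone would not suffice under a derivative; the
    symbols agree on the whole open chart.\<close>
  have "partial k (\<lambda>y. christoffel g y a d b) x = partial k (\<lambda>y. \<Gamma> y a d b) x" for k a d b
    by (rule partial_cong[OF open_vaidya_chart[OF open_U] assms christoffel_vaidya])
  then show ?thesis
    by (simp add: riemann_def christoffel_vaidya[OF assms])
qed

lemma partial_\<Gamma>_simps:
  assumes "x \<in> vaidya_chart U"
  shows "partial k (\<lambda>y. 1 / y $ 1) x = (if k = 1 then - 1 / (x $ 1)\<^sup>2 else 0)"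
  and "partial k (\<lambda>y. - y $ 1) x = (if k = 1 then -1 else 0)"
  and "partial 0 (\<lambda>y. - (y $ 1 * (sin (y $ 2))\<^sup>2)) x = 0"
  and "partial 1 (\<lambda>y. H1 (y $ 0, y $ 1) / 2) x = H2 (x $ 0, x $ 1) / 2"
  and "partial 1 (\<lambda>y. - (H1 (y $ 0, y $ 1) / 2)) x = - (H2 (x $ 0, x $ 1) / 2)"
  and "partial 1 (\<lambda>y. - (h y * y $ 1)) x = - H1 (x $ 0, x $ 1) * x $ 1 - h x"
  and "partial 1 (\<lambda>y. - (h y * y $ 1 * (sin (y $ 2))\<^sup>2)) x =
     (- H1 (x $ 0, x $ 1) * x $ 1 - h x) * (sin (x $ 2))\<^sup>2"
  and "partial 2 (\<lambda>y. - (sin (y $ 2) * cos (y $ 2))) x = (sin (x $ 2))\<^sup>2 - (cos (x $ 2))\<^sup>2"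
  and "partial 2 (\<lambda>y. cos (y $ 2) / sin (y $ 2)) x = - 1 / (sin (x $ 2))\<^sup>2"
proof -
  note pos = chart_pos[OF assms]
  note [derivative_intros] = h_radial_deriv[OF assms] H1_radial_deriv[OF assms]
  show "partial k (\<lambda>y. 1 / y $ 1) x = (if k = 1 then - 1 / (x $ 1)\<^sup>2 else 0)"
    using pos by (intro partial_eqI, unfold add_axis_nth)
      (auto intro!: derivative_eq_intros simp: power2_eq_square)
  show "partial k (\<lambda>y. - y $ 1) x = (if k = 1 then -1 else 0)"
    by (rule partial_eqI, unfold add_axis_nth) (auto intro!: derivative_eq_intros)
  show "partial 0 (\<lambda>y. - (y $ 1 * (sin (y $ 2))\<^sup>2)) x = 0"
    by (rule partial_eqI, unfold add_axis_nth) (auto intro!: derivative_eq_intros)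
  show "partial 1 (\<lambda>y. H1 (y $ 0, y $ 1) / 2) x = H2 (x $ 0, x $ 1) / 2"
    "partial 1 (\<lambda>y. - (H1 (y $ 0, y $ 1) / 2)) x = - (H2 (x $ 0, x $ 1) / 2)"
    "partial 1 (\<lambda>y. - (h y * y $ 1)) x = - H1 (x $ 0, x $ 1) * x $ 1 - h x"
    "partial 1 (\<lambda>y. - (h y * y $ 1 * (sin (y $ 2))\<^sup>2)) x =
     (- H1 (x $ 0, x $ 1) * x $ 1 - h x) * (sin (x $ 2))\<^sup>2"
    "partial 2 (\<lambda>y. - (sin (y $ 2) * cos (y $ 2))) x = (sin (x $ 2))\<^sup>2 - (cos (x $ 2))\<^sup>2"
    by (rule partial_eqI, unfold add_axis_nth,
        auto intro!: derivative_eq_intros simp: power2_eq_square left_diff_distrib distrib_right)+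
  \<comment> \<open>The quotient rule for the cotangent gives this numerator, which the Pythagorean
    identity then turns into -1.\<close>
  have "((\<lambda>t. cos (x $ 2 + t) / sin (x $ 2 + t)) has_real_derivative
      - ((sin (x $ 2))\<^sup>2 + (cos (x $ 2))\<^sup>2) / (sin (x $ 2))\<^sup>2) (at 0)"
    using pos by (auto intro!: derivative_eq_intros simp: power2_eq_square)
  then show "partial 2 (\<lambda>y. cos (y $ 2) / sin (y $ 2)) x = - 1 / (sin (x $ 2))\<^sup>2"
    by (intro partial_eqI, unfold add_axis_nth) simp
qed

text \<open>These are the components met by nonzero entries of the inverse metric. In R_11 the two
  angular terms each contribute \<open>1 / r\<^sup>2 - (1 / r)\<^sup>2 = 0\<close>.\<close>

lemma ricci_vaidya:
  assumes "x \<in> vaidya_chart U"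
  shows "ricci g x $ 1 $ 1 = 0"
    and "ricci g x $ 0 $ 1 = - (H2 (x $ 0, x $ 1) / 2 + H1 (x $ 0, x $ 1) / x $ 1)"
    and "ricci g x $ 1 $ 0 = - (H2 (x $ 0, x $ 1) / 2 + H1 (x $ 0, x $ 1) / x $ 1)"
    and "ricci g x $ 2 $ 2 = 1 - h x - x $ 1 * H1 (x $ 0, x $ 1)"
    and "ricci g x $ 3 $ 3 = (1 - h x - x $ 1 * H1 (x $ 0, x $ 1)) * (sin (x $ 2))\<^sup>2"
proof -
  note pos = chart_pos[OF assms]
  note rules = ricci_def riemann_vaidya[OF assms] sum_index \<Gamma>_def partial_\<Gamma>_simps[OF assms]
  show "ricci g x $ 1 $ 1 = 0"
    using pos by (simp add: rules power2_eq_square)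
  show "ricci g x $ 0 $ 1 = - (H2 (x $ 0, x $ 1) / 2 + H1 (x $ 0, x $ 1) / x $ 1)"
    using pos by (simp add: rules field_simps)
  show "ricci g x $ 1 $ 0 = - (H2 (x $ 0, x $ 1) / 2 + H1 (x $ 0, x $ 1) / x $ 1)"
    using pos by (simp add: rules field_simps)
  have c: "(cos (x $ 2))\<^sup>2 = 1 - (sin (x $ 2))\<^sup>2"
    by (rule cos_squared_eq)
  show "ricci g x $ 2 $ 2 = 1 - h x - x $ 1 * H1 (x $ 0, x $ 1)"
    using pos by (simp add: rules) (simp add: field_simps c flip: power2_eq_square)
  show "ricci g x $ 3 $ 3 = (1 - h x - x $ 1 * H1 (x $ 0, x $ 1)) * (sin (x $ 2))\<^sup>2"
    using pos by (simp add: rules) (simp add: field_simps c power2_eq_square)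
qed

text \<open>In the contraction the mixed term counts twice, R_11 drops out, and both angular terms
  agree once \<open>sin\<^sup>2\<close> cancels.\<close>

lemma ricci_scalar_vaidya:
  assumes "x \<in> vaidya_chart U"
  shows "ricci_scalar g x = - H2 (x $ 0, x $ 1) - 4 * H1 (x $ 0, x $ 1) / x $ 1
    + 2 * (1 - h x) / (x $ 1)\<^sup>2"
  unfolding ricci_scalar_def metric_trace_def matrix_inv_vaidya[OF assms] sum_index
  using chart_pos[OF assms]
  by (simp add: ricci_vaidya[OF assms] field_simps power2_eq_square)

text \<open>A purely algebraic collapse: R_11 = 0 removes the first term, g_11 = 0 the second and
  the box term, and the vanishing \<open>\<Gamma> x k 1 1\<close> leave a plain second derivative in
  the Hessian.\<close>

lemma fR_field_tensor_11:
  assumes "x \<in> vaidya_chart U"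
  shows "fR_field_tensor f g x $ 1 $ 1 = - partial 1 (partial 1 (f_R f g)) x"
  using ricci_vaidya(1)[OF assms]
  by (simp add: fR_field_tensor_def hessian_def cov_deriv_def differential_def
      christoffel_vaidya[OF assms] sum_index \<Gamma>_def vaidya_metric_def)

end

lemma vaidya_stress_11: "vaidya_stress M \<mu> \<rho> p x $ 1 $ 1 = 0"
  by (simp add: vaidya_stress_def vaidya_l_def vaidya_metric_def axis_def)

section \<open>One-variable derivatives of smooth functions\<close>

lemma smooth_on_has_derivative:
  assumes "smooth_on S F" "x \<in> S"
  shows "(F has_derivative frechet_derivative F (at x)) (at x)"
proof -
  have "differentiable_times (Suc 0) S F"
    using assms(1) unfolding smooth_on_def by blast
  with assms(2) show ?thesis
    by (simp add: frechet_derivative_works)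
qed

lemma smooth_on_frechet_derivative:
  assumes "smooth_on S F"
  shows "smooth_on S (\<lambda>x. frechet_derivative F (at x) v)"
  unfolding smooth_on_def
proof
  fix k
  have "differentiable_times (Suc k) S F"
    using assms unfolding smooth_on_def by blast
  then show "differentiable_times k S (\<lambda>x. frechet_derivative F (at x) v)"
    by simp
qed

lemma smooth_on_DERIV:
  fixes F :: "real \<Rightarrow> real"
  assumes "smooth_on S F" "x \<in> S"
  shows "(F has_real_derivative frechet_derivative F (at x) 1) (at x)"
proof (rule has_derivative_imp_has_field_derivative[OF smooth_on_has_derivative[OF assms]])
  have lin: "linear (frechet_derivative F (at x))"
    using smooth_on_has_derivative[OF assms] has_derivative_linear by blast
  show "h * frechet_derivative F (at x) 1 = frechet_derivative F (at x) h" for h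
    using linear_scale[OF lin, of h 1] by simp
qed

text \<open>Composing with the line \<open>s \<mapsto> (v, s)\<close>, whose derivative is
  \<open>t \<mapsto> (0, t)\<close>, identifies the radial derivative with the Frechet derivative in
  direction \<open>(0, 1)\<close>.\<close>

lemma smooth_on_DERIV_snd:
  fixes F :: "real \<times> real \<Rightarrow> real"
  assumes "smooth_on S F" "(v, r) \<in> S"
  shows "((\<lambda>s. F (v, s)) has_real_derivative frechet_derivative F (at (v, r)) (0, 1)) (at r)"
proof (rule has_derivative_imp_has_field_derivative)
  note D = smooth_on_has_derivative[OF assms]
  have "((\<lambda>s. (v, s)) has_derivative (\<lambda>t. (0, t))) (at r)"
    by (auto intro!: derivative_eq_intros)
  from has_derivative_compose[OF this D]
  show "((\<lambda>s. F (v, s)) has_derivative (\<lambda>t. frechet_derivative F (at (v, r)) (0, t))) (at r)" .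
  have lin: "linear (frechet_derivative F (at (v, r)))"
    using D has_derivative_linear by blast
  show "h * frechet_derivative F (at (v, r)) (0, 1) = frechet_derivative F (at (v, r)) (0, h)" for h
    using linear_scale[OF lin, of h "(0, 1)"] by simp
qed

text \<open>A zero derivative on a convex set forces a constant: first for \<open>F'\<close>, giving
  the slope \<open>a\<close>, then for \<open>F r - a * r\<close>, giving \<open>b\<close>. The
  empty interval is included.\<close>

lemma affine_on_interval:
  fixes F :: "real \<Rightarrow> real"
  assumes "is_interval I"
    and "\<And>r. r \<in> I \<Longrightarrow> (F has_real_derivative F' r) (at r)"
    and "\<And>r. r \<in> I \<Longrightarrow> (F' has_real_derivative 0) (at r)"
  shows "\<exists>a b. \<forall>r\<in>I. F r = a * r + b"
proof -
  have "convex I"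
    using assms(1) by (simp add: is_interval_convex)
  obtain a where a: "\<And>r. r \<in> I \<Longrightarrow> F' r = a"
    using has_field_derivative_zero_constant[OF \<open>convex I\<close>
        has_field_derivative_at_within[OF assms(3)]] by blast
  have "((\<lambda>r. F r - a * r) has_real_derivative 0) (at r within I)" if "r \<in> I" for r
    using assms(2)[OF that] a[OF that]
    by - (rule has_field_derivative_at_within, auto intro!: derivative_eq_intros)
  from has_field_derivative_zero_constant[OF \<open>convex I\<close> this]
  obtain b where "\<And>r. r \<in> I \<Longrightarrow> F r - a * r = b" by blast
  then have "\<forall>r\<in>I. F r = a * r + b"
    by (simp add: algebra_simps)
  then show ?thesis by blast
qed

section \<open>Radial dependence of \<open>f_R\<close>\<close>

theorem proposition5:
  fixes f :: "real \<Rightarrow> real" and D :: "real set"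
    and M :: "real \<times> real \<Rightarrow> real" and U :: "(real \<times> real) set"
    and \<mu> \<rho> p :: "real ^ 4 \<Rightarrow> real" and \<kappa> G :: real
  assumes "open D" and "smooth_on D f"
    and "open U" and "U \<subseteq> {(v, r). r > 0}"
    and "\<And>v. is_interval {r. (v, r) \<in> U}"
    and "smooth_on U M"
    and "\<And>x. x \<in> vaidya_chart U \<Longrightarrow> ricci_scalar (vaidya_metric M) x \<in> D"
    and "\<kappa> = 8 * pi * G"
    and "\<And>x. x \<in> vaidya_chart U \<Longrightarrow>
           fR_field_tensor f (vaidya_metric M) x $ 1 $ 1 = \<kappa> * vaidya_stress M \<mu> \<rho> p x $ 1 $ 1"
  shows "\<exists>A B :: real \<Rightarrow> real. \<forall>x \<in> vaidya_chart U.
           deriv f (ricci_scalar (vaidya_metric M) x) = A (x $ 0) * x $ 1 + B (x $ 0)"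
proof -
  have pos: "r > 0" if "(v, r) \<in> U" for v r
    using assms(4) that by auto
  define d :: "(real \<times> real \<Rightarrow> real) \<Rightarrow> real \<times> real \<Rightarrow> real"
    where "d F p = frechet_derivative F (at p) (0, 1)" for F p
  \<comment> \<open>Four radial derivatives of \<open>M\<close> appear: the scalar curvature
    contains the second, and \<open>f_R\<close> is differentiated twice more.\<close>
  define M1 where "M1 = d M"
  define M2 where "M2 = d M1"
  define M3 where "M3 = d M2"
  define M4 where "M4 = d M3"
  have smooth_d: "smooth_on U (d F)" if "smooth_on U F" for F
    using smooth_on_frechet_derivative[OF that] by (simp add: d_def[abs_def])
  have sm: "smooth_on U M1" "smooth_on U M2" "smooth_on U M3"
    by (simp_all add: M1_def M2_def M3_def smooth_d \<open>smooth_on U M\<close>)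
  have d: "((\<lambda>s. F (v, s)) has_real_derivative d F (v, r)) (at r)"
    if "smooth_on U F" "(v, r) \<in> U" for F v r
    using smooth_on_DERIV_snd[OF that] by (simp add: d_def)
  note M_deriv = d[OF \<open>smooth_on U M\<close>, folded M1_def] d[OF sm(1), folded M2_def]
    d[OF sm(2), folded M3_def] d[OF sm(3), folded M4_def]

  \<comment> \<open>The first two radial derivatives of \<open>1 - 2 * M / r\<close>.\<close>
  define H1 where "H1 = (\<lambda>(v, r). 2 * M (v, r) / r ^ 2 - 2 * M1 (v, r) / r)"
  define H2 where "H2 = (\<lambda>(v, r). 4 * M1 (v, r) / r ^ 2 - 4 * M (v, r) / r ^ 3 - 2 * M2 (v, r) / r)"
  interpret vaidya U M H1 H2
  proof
    fix v r assume vr: "(v, r) \<in> U"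
    then show "r > 0" by (rule pos)
    show "((\<lambda>s. lapse M (v, s)) has_real_derivative H1 (v, r)) (at r)"
      using pos[OF vr] unfolding lapse_def H1_def
      by (auto intro!: derivative_eq_intros M_deriv[OF vr] simp: field_simps power2_eq_square)
    show "((\<lambda>s. H1 (v, s)) has_real_derivative H2 (v, r)) (at r)"
      using pos[OF vr] unfolding H1_def H2_def prod.case
      by (auto intro!: derivative_eq_intros M_deriv[OF vr] simp: field_simps eval_nat_numeral)
  qed (rule \<open>open U\<close>)

  \<comment> \<open>The scalar curvature after substituting the lapse, where the undifferentiated
    \<open>M\<close> cancels, followed by its two radial derivatives.\<close>
  define R where "R = (\<lambda>(v, r). 2 * M2 (v, r) / r + 4 * M1 (v, r) / r ^ 2)"
  define R1 where "R1 = (\<lambda>(v, r). 2 * M3 (v, r) / r + 2 * M2 (v, r) / r ^ 2 - 8 * M1 (v, r) / r ^ 3)"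
  define R2 where "R2 = (\<lambda>(v, r). 2 * M4 (v, r) / r - 12 * M2 (v, r) / r ^ 3 + 24 * M1 (v, r) / r ^ 4)"
  have R_deriv: "((\<lambda>s. R (v, s)) has_real_derivative R1 (v, r)) (at r)"
      "((\<lambda>s. R1 (v, s)) has_real_derivative R2 (v, r)) (at r)" if "(v, r) \<in> U" for v r
    using pos[OF that] unfolding R_def R1_def R2_def prod.case
    by (auto intro!: derivative_eq_intros M_deriv[OF that] simp: field_simps eval_nat_numeral)
  have scalar: "ricci_scalar g x = R (x $ 0, x $ 1)" if "x \<in> vaidya_chart U" for x
    unfolding ricci_scalar_vaidya[OF that] R_def H1_def H2_def lapse_def
    using chart_pos[OF that] by (simp add: field_simps eval_nat_numeral)

  \<comment> \<open>Any point of the sphere chart would do; this one, on the equator, lifts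
    \<open>(v, r)\<close> so that facts about the chart yield facts about \<open>U\<close>.\<close>
  define \<iota> :: "real \<Rightarrow> real \<Rightarrow> real ^ 4"
    where "\<iota> v r = (\<chi> i. if i = 0 then v else if i = 1 then r else if i = 2 then pi / 2 else pi)" for v r
  have \<iota>: "\<iota> v r $ 0 = v" "\<iota> v r $ 1 = r" for v r
    by (simp_all add: \<iota>_def)
  have \<iota>_chart: "\<iota> v r \<in> vaidya_chart U" if "(v, r) \<in> U" for v r
    using that by (simp add: vaidya_chart_def \<iota>_def)
  have RD: "R (v, r) \<in> D" if "(v, r) \<in> U" for v r
    using assms(7)[OF \<iota>_chart[OF that]] scalar[OF \<iota>_chart[OF that]] by (simp add: \<iota>)

  define f1 where "f1 x = frechet_derivative f (at x) 1" for x
  define f2 where "f2 x = frechet_derivative f1 (at x) 1" for x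
  define f3 where "f3 x = frechet_derivative f2 (at x) 1" for x
  have f1: "smooth_on D f1"
    unfolding f1_def[abs_def] by (rule smooth_on_frechet_derivative[OF \<open>smooth_on D f\<close>])
  have f2: "smooth_on D f2"
    unfolding f2_def[abs_def] by (rule smooth_on_frechet_derivative[OF f1])
  have f_deriv: "deriv f y = f1 y" "(f1 has_real_derivative f2 y) (at y)"
      "(f2 has_real_derivative f3 y) (at y)" if "y \<in> D" for y
    using smooth_on_DERIV[OF \<open>smooth_on D f\<close> that] smooth_on_DERIV[OF f1 that]
      smooth_on_DERIV[OF f2 that]
    by (simp_all add: f1_def f2_def f3_def DERIV_imp_deriv)

  \<comment> \<open>\<open>f_R\<close> as a function of \<open>(v, r)\<close>, with its first two
    radial derivatives by the chain and product rules.\<close>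
  define \<phi> where "\<phi> p = f1 (R p)" for p
  define \<phi>1 where "\<phi>1 p = f2 (R p) * R1 p" for p
  define \<phi>2 where "\<phi>2 p = f3 (R p) * R1 p * R1 p + f2 (R p) * R2 p" for p
  have \<phi>_deriv: "((\<lambda>s. \<phi> (v, s)) has_real_derivative \<phi>1 (v, r)) (at r)"
      "((\<lambda>s. \<phi>1 (v, s)) has_real_derivative \<phi>2 (v, r)) (at r)" if vr: "(v, r) \<in> U" for v r
  proof -
    note [derivative_intros] = R_deriv[OF vr]
      DERIV_chain2[OF f_deriv(2)[OF RD[OF vr]] R_deriv(1)[OF vr]]
      DERIV_chain2[OF f_deriv(3)[OF RD[OF vr]] R_deriv(1)[OF vr]]
    show "((\<lambda>s. \<phi> (v, s)) has_real_derivative \<phi>1 (v, r)) (at r)"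
      unfolding \<phi>_def \<phi>1_def by (auto intro!: derivative_eq_intros)
    show "((\<lambda>s. \<phi>1 (v, s)) has_real_derivative \<phi>2 (v, r)) (at r)"
      unfolding \<phi>1_def \<phi>2_def by (auto intro!: derivative_eq_intros)
  qed
  have f_R: "f_R f g x = \<phi> (x $ 0, x $ 1)" if "x \<in> vaidya_chart U" for x
    using f_deriv(1) assms(7)[OF that] by (simp add: f_R_def \<phi>_def scalar[OF that])
  have partial_f_R: "partial 1 (f_R f g) x = \<phi>1 (x $ 0, x $ 1)" if "x \<in> vaidya_chart U" for x
    using partial_radial[OF \<open>open U\<close> that, of "f_R f g" \<phi>] f_R \<phi>_deriv chart_pos[OF that] by blast
  \<comment> \<open>The (1,1) field equation at the lifted point: its right side vanishes whatever
    \<open>\<kappa>\<close> is, and its left side is \<open>- \<phi>2 (v, r)\<close>.\<close>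
  have \<phi>2: "\<phi>2 (v, r) = 0" if "(v, r) \<in> U" for v r
  proof -
    let ?x = "\<iota> v r"
    note x = \<iota>_chart[OF that]
    have "partial 1 (partial 1 (f_R f g)) ?x = \<phi>2 (v, r)"
      using partial_radial[OF \<open>open U\<close> x, of "partial 1 (f_R f g)" \<phi>1] partial_f_R \<phi>_deriv(2)[OF that] by (simp add: \<iota>)
    moreover have "partial 1 (partial 1 (f_R f g)) ?x = 0"
      using assms(9)[OF x] by (simp add: fR_field_tensor_11[OF x] vaidya_stress_11)
    ultimately show ?thesis by simp
  qed
  have "\<exists>a b. \<forall>r\<in>{r. (v, r) \<in> U}. \<phi> (v, r) = a * r + b" for v
    using \<phi>_deriv \<phi>2
    by (intro affine_on_interval[OF assms(5), where F' = "\<lambda>r. \<phi>1 (v, r)"]) fastforce+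
  \<comment> \<open>Choosing a slope and an intercept for each \<open>v\<close> gives the two
    functions; where the slice of \<open>U\<close> is empty their values are arbitrary.\<close>
  then obtain A B where "\<And>v r. (v, r) \<in> U \<Longrightarrow> \<phi> (v, r) = A v * r + B v"
    by (metis mem_Collect_eq)
  then have "\<forall>x\<in>vaidya_chart U. deriv f (ricci_scalar g x) = A (x $ 0) * x $ 1 + B (x $ 0)"
    using f_R chart_pos(1) by (simp add: f_R_def)
  then show ?thesis by blast
qed

end
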